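(* Let $(\boldsymbol{x},\boldsymbol{n},\boldsymbol{s}):U\to\mathbb{R}^3\times\Delta$ be a framed surface with basic invariants $a_i,b_i,e_i,f_i,g_i$ ($i=1,2$). Then $(\boldsymbol{x},\boldsymbol{n},\boldsymbol{s})$ is a $(\boldsymbol{t},\overline{\boldsymbol{s}})$-Bertrand framed surface if and only if there exist smooth functions $\lambda,\theta:U\to\mathbb{R}$ with $\lambda\not\equiv0$ such that $$\begin{pmatrix} \lambda(u,v)f_1(u,v) & a_1(u,v)-\lambda(u,v)g_1(u,v)\\ \lambda(u,v)f_2(u,v) & a_2(u,v)-\lambda(u,v)g_2(u,v)\end{pmatrix}\begin{pmatrix}-\sin\theta(u,v)\\ \cos\theta(u,v)\end{pmatrix}=\begin{pmatrix}0\\0\end{pmatrix}$$ for all $(u,v)\in U$.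
   Context: All maps are $C^\infty$. $U\subset\mathbb{R}^2$ is a simply connected domain with coordinates $(u,v)$, $S^2$ is the unit sphere in $\mathbb{R}^3$, and $\Delta=\{(\boldsymbol{a},\boldsymbol{b})\in S^2\times S^2 : \boldsymbol{a}\cdot\boldsymbol{b}=0\}$. A framed surface is a smooth map $(\boldsymbol{x},\boldsymbol{n},\boldsymbol{s}):U\to\mathbb{R}^3\times\Delta$ with $\boldsymbol{x}_u\cdot\boldsymbol{n}=\boldsymbol{x}_v\cdot\boldsymbol{n}=0$ on $U$. Put $\boldsymbol{t}=\boldsymbol{n}\times\boldsymbol{s}$. Its basic invariants are the smooth functions $a_i,b_i,e_i,f_i,g_i:U\to\mathbb{R}$ ($i=1,2$) determined by $\boldsymbol{x}_u=a_1\boldsymbol{s}+b_1\boldsymbol{t}$, $\boldsymbol{n}_u=e_1\boldsymbol{s}+f_1\boldsymbol{t}$, $\boldsymbol{s}_u=-e_1\boldsymbol{n}+g_1\boldsymbol{t}$, $\boldsymbol{t}_u=-f_1\boldsymbol{n}-g_1\boldsymbol{s}$, and the same equations with $\partial_v$ in place of $\partial_u$ and index $2$ in place of $1$. For a smooth $\lambda:U\to\mathbb{R}$, $\lambda\not\equiv0$ means that $\{(u,v)\in U:\lambda(u,v)\neq0\}$ is dense in $U$. Two framed surfaces $(\boldsymbol{x},\boldsymbol{n},\boldsymbol{s}),(\overline{\boldsymbol{x}},\overline{\boldsymbol{n}},\overline{\boldsymbol{s}}):U\to\mathbb{R}^3\times\Delta$ (with $\overline{\boldsymbol{t}}=\overline{\boldsymbol{n}}\times\overline{\boldsymbol{s}}$)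 are $(\boldsymbol{v},\overline{\boldsymbol{w}})$-mates, where each of $\boldsymbol{v},\boldsymbol{w}$ is one of $\boldsymbol{n},\boldsymbol{s},\boldsymbol{t}$, if there is a smooth $\lambda:U\to\mathbb{R}$ with $\lambda\not\equiv0$ such that $\overline{\boldsymbol{x}}=\boldsymbol{x}+\lambda\boldsymbol{v}$ and $\boldsymbol{v}=\overline{\boldsymbol{w}}$ on $U$. $(\boldsymbol{x},\boldsymbol{n},\boldsymbol{s})$ is a $(\boldsymbol{v},\overline{\boldsymbol{w}})$-Bertrand framed surface if there is a framed surface $(\overline{\boldsymbol{x}},\overline{\boldsymbol{n}},\overline{\boldsymbol{s}}):U\to\mathbb{R}^3\times\Delta$ such that the two are $(\boldsymbol{v},\overline{\boldsymbol{w}})$-mates. *)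

theory Defs
  imports "HOL-Analysis.Analysis"
begin

text \<open>
  \<open>C_k_on k U f\<close> and \<open>smooth_on U f\<close> are meant for open \<open>U\<close>: all derivatives are taken with
  respect to the full neighbourhood filter \<open>at p\<close>, so values of \<open>f\<close> outside \<open>U\<close> are irrelevant.
\<close>

fun C_k_on :: "nat \<Rightarrow> 'a::real_normed_vector set \<Rightarrow> ('a \<Rightarrow> 'b::real_normed_vector) \<Rightarrow> bool" where
  "C_k_on 0 U f \<longleftrightarrow> continuous_on U f"
| "C_k_on (Suc k) U f \<longleftrightarrow>
     (\<forall>p\<in>U. f differentiable (at p)) \<and>
     (\<forall>h. C_k_on k U (\<lambda>p. frechet_derivative f (at p) h))"

definition smooth_on :: "'a::real_normed_vector set \<Rightarrow> ('a \<Rightarrow> 'b::real_normed_vector) \<Rightarrow> bool" where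
  "smooth_on U f \<longleftrightarrow> (\<forall>k. C_k_on k U f)"

definition partial_u :: "(real \<times> real \<Rightarrow> 'b::real_normed_vector) \<Rightarrow> real \<times> real \<Rightarrow> 'b" where
  "partial_u f p = frechet_derivative f (at p) (1, 0)"

definition partial_v :: "(real \<times> real \<Rightarrow> 'b::real_normed_vector) \<Rightarrow> real \<times> real \<Rightarrow> 'b" where
  "partial_v f p = frechet_derivative f (at p) (0, 1)"

definition simply_connected_domain :: "(real \<times> real) set \<Rightarrow> bool" where
  "simply_connected_domain U \<longleftrightarrow> open U \<and> connected U \<and> U \<noteq> {} \<and> simply_connected U"

definition Delta :: "((real^3) \<times> (real^3)) set" where
  "Delta = {(a, b). a \<in> sphere 0 1 \<and> b \<in> sphere 0 1 \<and> a \<bullet> b = 0}"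

definition framed_surface ::
  "(real \<times> real) set \<Rightarrow> (real \<times> real \<Rightarrow> real^3) \<Rightarrow> (real \<times> real \<Rightarrow> real^3) \<Rightarrow> (real \<times> real \<Rightarrow> real^3) \<Rightarrow> bool"
where
  "framed_surface U x n s \<longleftrightarrow>
     smooth_on U x \<and> smooth_on U n \<and> smooth_on U s \<and>
     (\<forall>p\<in>U. (n p, s p) \<in> Delta \<and> partial_u x p \<bullet> n p = 0 \<and> partial_v x p \<bullet> n p = 0)"

definition frame_t :: "(real \<times> real \<Rightarrow> real^3) \<Rightarrow> (real \<times> real \<Rightarrow> real^3) \<Rightarrow> real \<times> real \<Rightarrow> real^3" where
  "frame_t n s = (\<lambda>p. cross3 (n p) (s p))"

text \<open>
  The argument order is \<open>U x n s a1 b1 e1 f1 g1 a2 b2 e2 f2 g2\<close>. The equations determine the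
  ten functions on \<open>U\<close> uniquely, since \<open>n\<close>, \<open>s\<close>, \<open>t\<close> is orthonormal there.
\<close>

definition basic_invariants ::
  "(real \<times> real) set \<Rightarrow> (real \<times> real \<Rightarrow> real^3) \<Rightarrow> (real \<times> real \<Rightarrow> real^3) \<Rightarrow> (real \<times> real \<Rightarrow> real^3) \<Rightarrow>
   (real \<times> real \<Rightarrow> real) \<Rightarrow> (real \<times> real \<Rightarrow> real) \<Rightarrow> (real \<times> real \<Rightarrow> real) \<Rightarrow> (real \<times> real \<Rightarrow> real) \<Rightarrow> (real \<times> real \<Rightarrow> real) \<Rightarrow>
   (real \<times> real \<Rightarrow> real) \<Rightarrow> (real \<times> real \<Rightarrow> real) \<Rightarrow> (real \<times> real \<Rightarrow> real) \<Rightarrow> (real \<times> real \<Rightarrow> real) \<Rightarrow> (real \<times> real \<Rightarrow> real) \<Rightarrow> bool"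
where
  "basic_invariants U x n s a1 b1 e1 f1 g1 a2 b2 e2 f2 g2 \<longleftrightarrow>
     smooth_on U a1 \<and> smooth_on U b1 \<and> smooth_on U e1 \<and> smooth_on U f1 \<and> smooth_on U g1 \<and>
     smooth_on U a2 \<and> smooth_on U b2 \<and> smooth_on U e2 \<and> smooth_on U f2 \<and> smooth_on U g2 \<and>
     (let t = frame_t n s in
      \<forall>p\<in>U.
        partial_u x p = a1 p *\<^sub>R s p + b1 p *\<^sub>R t p \<and>
        partial_u n p = e1 p *\<^sub>R s p + f1 p *\<^sub>R t p \<and>
        partial_u s p = - e1 p *\<^sub>R n p + g1 p *\<^sub>R t p \<and>
        partial_u t p = - f1 p *\<^sub>R n p - g1 p *\<^sub>R s p \<and>
        partial_v x p = a2 p *\<^sub>R s p + b2 p *\<^sub>R t p \<and>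
        partial_v n p = e2 p *\<^sub>R s p + f2 p *\<^sub>R t p \<and>
        partial_v s p = - e2 p *\<^sub>R n p + g2 p *\<^sub>R t p \<and>
        partial_v t p = - f2 p *\<^sub>R n p - g2 p *\<^sub>R s p)"

definition densely_nonzero_on :: "'a::topological_space set \<Rightarrow> ('a \<Rightarrow> real) \<Rightarrow> bool" where
  "densely_nonzero_on U l \<longleftrightarrow> U \<subseteq> closure {p \<in> U. l p \<noteq> 0}"

datatype frame_label = Dir_n | Dir_s | Dir_t

fun frame_vec ::
  "frame_label \<Rightarrow> (real \<times> real \<Rightarrow> real^3) \<Rightarrow> (real \<times> real \<Rightarrow> real^3) \<Rightarrow> real \<times> real \<Rightarrow> real^3"
where
  "frame_vec Dir_n n s = n"
| "frame_vec Dir_s n s = s"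
| "frame_vec Dir_t n s = frame_t n s"

text \<open>
  The label \<open>d\<close> selects a frame vector of the first surface, \<open>d'\<close> one of the second surface
  (the barred one).
\<close>

definition mates ::
  "(real \<times> real) set \<Rightarrow> frame_label \<Rightarrow> frame_label \<Rightarrow>
   (real \<times> real \<Rightarrow> real^3) \<Rightarrow> (real \<times> real \<Rightarrow> real^3) \<Rightarrow> (real \<times> real \<Rightarrow> real^3) \<Rightarrow>
   (real \<times> real \<Rightarrow> real^3) \<Rightarrow> (real \<times> real \<Rightarrow> real^3) \<Rightarrow> (real \<times> real \<Rightarrow> real^3) \<Rightarrow> bool"
where
  "mates U d d' x n s x' n' s' \<longleftrightarrow>
     framed_surface U x n s \<and> framed_surface U x' n' s' \<and>
     (\<exists>l :: real \<times> real \<Rightarrow> real. smooth_on U l \<and> densely_nonzero_on U l \<and>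
        (\<forall>p\<in>U. x' p = x p + l p *\<^sub>R frame_vec d n s p \<and>
               frame_vec d n s p = frame_vec d' n' s' p))"

definition Bertrand_framed_surface ::
  "(real \<times> real) set \<Rightarrow> frame_label \<Rightarrow> frame_label \<Rightarrow>
   (real \<times> real \<Rightarrow> real^3) \<Rightarrow> (real \<times> real \<Rightarrow> real^3) \<Rightarrow> (real \<times> real \<Rightarrow> real^3) \<Rightarrow> bool"
where
  "Bertrand_framed_surface U d d' x n s \<longleftrightarrow> (\<exists>x' n' s'. mates U d d' x n s x' n' s')"

end

theory Submission
  imports Defs
begin

text \<open>
  Write \<open>t = n \<times> s\<close> and let \<open>x' = x + l t\<close>. By the structure equations,
  \<open>x'_u = (a1 - l g1) s - l f1 n + (b1 + l_u) t\<close>,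
  and similarly along \<open>v\<close>. A unit field \<open>n'\<close> orthogonal to \<open>t\<close> has the form
  \<open>sin \<theta> n + cos \<theta> s\<close>, and for such a field \<open>x'_u \<bullet> n' = x'_v \<bullet> n' = 0\<close> is precisely the
  stated linear system (lemma \<open>deriv_offset_inner\<close> is applied in both directions).

  Given \<open>l\<close> and \<open>\<theta>\<close>, the triple \<open>(x', sin \<theta> n + cos \<theta> s, t)\<close> is therefore a mate. Conversely,
  a mate has \<open>s' = t\<close>, so \<open>n'\<close> is orthogonal to \<open>t\<close> and the pair \<open>(n' \<bullet> s, n' \<bullet> n)\<close> is a
  smooth map from \<open>U\<close> to the unit circle. The remaining point is to write it as
  \<open>(cos \<theta>, sin \<theta>)\<close> with a single smooth \<open>\<theta>\<close> on all of \<open>U\<close>. This is where simple connectedness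
  enters: it gives a continuous logarithm of the circle-valued map, and the resulting angle is
  smooth because locally it is a constant plus the arcsine of a smooth function (lemmas
  \<open>smooth_angle_lift\<close> and \<open>continuous_angle_has_derivative\<close>).
\<close>

section \<open>Calculus of smooth functions\<close>

lemma C_k_on_cong:
  assumes "open U" "\<And>p. p \<in> U \<Longrightarrow> f p = g p" "C_k_on k U f"
  shows "C_k_on k U g"
  using assms(2,3)
proof (induction k arbitrary: f g)
  case 0
  then show ?case using continuous_on_cong[of U U f g] by simp
next
  case (Suc k)
  have D: "frechet_derivative f (at p) = frechet_derivative g (at p)" if "p \<in> U" for p
    using frechet_derivative_transform_within_open[of f p U g] Suc.prems that assms(1) by auto
  have "g differentiable (at p)" if "p \<in> U" for p
  proof -
    have "(f has_derivative frechet_derivative f (at p)) (at p)"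
      using Suc.prems(2) that frechet_derivative_works by auto
    then have "(g has_derivative frechet_derivative f (at p)) (at p)"
      using has_derivative_transform_within_open[OF _ assms(1) that] Suc.prems(1) by blast
    then show ?thesis by (rule differentiableI)
  qed
  moreover have "C_k_on k U (\<lambda>p. frechet_derivative g (at p) h)" for h
    using Suc.IH[of "\<lambda>p. frechet_derivative f (at p) h" "\<lambda>p. frechet_derivative g (at p) h"]
      D Suc.prems(2) by simp
  ultimately show ?case by simp
qed

text \<open>
  The defining recursion speaks of \<open>frechet_derivative\<close>, a choice operator. This rule lets one
  supply an explicit derivative \<open>D\<close> instead; the closure properties below rest on it.
\<close>

lemma C_k_on_SucI:
  assumes "open U" "\<And>p. p \<in> U \<Longrightarrow> (f has_derivative D p) (at p)"
    and "\<And>h. C_k_on k U (\<lambda>p. D p h)"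
  shows "C_k_on (Suc k) U f"
proof -
  have "C_k_on k U (\<lambda>p. frechet_derivative f (at p) h)" for h
    by (rule C_k_on_cong[OF assms(1) _ assms(3)[of h]])
      (simp add: frechet_derivative_at[OF assms(2), symmetric])
  then show ?thesis using assms(2) by (auto intro: differentiableI)
qed

lemma C_k_on_Suc_has_derivative:
  assumes "C_k_on (Suc k) U f" "p \<in> U"
  shows "(f has_derivative frechet_derivative f (at p)) (at p)"
  using assms frechet_derivative_works by auto

lemma C_k_on_SucD: "C_k_on (Suc k) U f \<Longrightarrow> C_k_on k U f"
proof (induction k arbitrary: f)
  case 0
  then show ?case
    by (auto intro!: continuous_at_imp_continuous_on differentiable_imp_continuous_within)
next
  case (Suc k)
  from Suc.prems have "\<And>h. C_k_on k U (\<lambda>p. frechet_derivative f (at p) h)"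
    using Suc.IH by (metis C_k_on.simps(2))
  with Suc.prems show ?case by (metis C_k_on.simps(2))
qed

lemma C_k_on_add:
  assumes "open U" "C_k_on k U f" "C_k_on k U g"
  shows "C_k_on k U (\<lambda>p. f p + g p)"
  using assms(2,3)
proof (induction k arbitrary: f g)
  case 0
  then show ?case by (simp add: continuous_on_add)
next
  case (Suc k)
  show ?case
  proof (rule C_k_on_SucI[OF assms(1)])
    show "((\<lambda>p. f p + g p) has_derivative
        (\<lambda>h. frechet_derivative f (at p) h + frechet_derivative g (at p) h)) (at p)" if "p \<in> U" for p
      by (intro has_derivative_add C_k_on_Suc_has_derivative[OF Suc.prems(1) that]
          C_k_on_Suc_has_derivative[OF Suc.prems(2) that])
    show "C_k_on k U (\<lambda>p. frechet_derivative f (at p) h + frechet_derivative g (at p) h)" for h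
      using Suc by simp
  qed
qed

text \<open>
  One Leibniz rule for all products that occur: multiplication, scaling, inner and cross product.
  Each of its two terms pairs a derivative with an undifferentiated factor, which has to be
  regarded as one order less smooth before the induction hypothesis applies.
\<close>

lemma C_k_on_bilinear:
  assumes "bounded_bilinear B" "open U" "C_k_on k U f" "C_k_on k U g"
  shows "C_k_on k U (\<lambda>p. B (f p) (g p))"
  using assms(3,4)
proof (induction k arbitrary: f g)
  case 0
  then show ?case using bounded_bilinear.continuous_on[OF assms(1)] by simp
next
  case (Suc k)
  show ?case
  proof (rule C_k_on_SucI[OF assms(2)])
    show "((\<lambda>p. B (f p) (g p)) has_derivative
        (\<lambda>h. B (f p) (frechet_derivative g (at p) h) + B (frechet_derivative f (at p) h) (g p))) (at p)"
      if "p \<in> U" for p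
      by (intro bounded_bilinear.FDERIV[OF assms(1)] C_k_on_Suc_has_derivative[OF Suc.prems(1) that]
          C_k_on_Suc_has_derivative[OF Suc.prems(2) that])
    show "C_k_on k U (\<lambda>p. B (f p) (frechet_derivative g (at p) h)
        + B (frechet_derivative f (at p) h) (g p))" for h
    proof (rule C_k_on_add[OF assms(2)])
      show "C_k_on k U (\<lambda>p. B (f p) (frechet_derivative g (at p) h))"
        by (rule Suc.IH[OF C_k_on_SucD[OF Suc.prems(1)]]) (use Suc.prems(2) in simp)
      show "C_k_on k U (\<lambda>p. B (frechet_derivative f (at p) h) (g p))"
        by (rule Suc.IH[OF _ C_k_on_SucD[OF Suc.prems(2)]]) (use Suc.prems(1) in simp)
    qed
  qed
qed

lemma C_k_on_const: "open U \<Longrightarrow> C_k_on k U (\<lambda>p. c)"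
proof (induction k arbitrary: c)
  case (Suc k)
  show ?case
    by (rule C_k_on_SucI[OF Suc.prems, where D = "\<lambda>p h. 0"])
      (simp, rule Suc.IH[OF Suc.prems])
qed simp

lemma C_k_on_diff:
  fixes f g :: "'a::real_normed_vector \<Rightarrow> real"
  assumes "open U" "C_k_on k U f" "C_k_on k U g"
  shows "C_k_on k U (\<lambda>p. f p - g p)"
  using C_k_on_add[OF assms(1,2) C_k_on_bilinear[OF bounded_bilinear_mult assms(1)
    C_k_on_const[OF assms(1), of k "- 1"] assms(3)]] by simp

text \<open>
  Sine and cosine are treated simultaneously because each is, up to sign, the derivative of the
  other.
\<close>

lemma C_k_on_sin_cos:
  fixes \<theta> :: "'a::real_normed_vector \<Rightarrow> real"
  assumes "open U" "C_k_on k U \<theta>"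
  shows "C_k_on k U (\<lambda>p. sin (\<theta> p)) \<and> C_k_on k U (\<lambda>p. cos (\<theta> p))"
  using assms(2)
proof (induction k)
  case 0
  then show ?case by (auto intro: continuous_intros)
next
  case (Suc k)
  let ?D = "\<lambda>p. frechet_derivative \<theta> (at p)"
  note D = C_k_on_Suc_has_derivative[OF Suc.prems]
  have sc: "C_k_on k U (\<lambda>p. sin (\<theta> p))" "C_k_on k U (\<lambda>p. cos (\<theta> p))"
    using Suc.IH C_k_on_SucD[OF Suc.prems] by auto
  have dk: "C_k_on k U (\<lambda>p. ?D p h)" for h using Suc.prems by simp
  note mult = C_k_on_bilinear[OF bounded_bilinear_mult assms(1)]
  have "C_k_on (Suc k) U (\<lambda>p. sin (\<theta> p))"
  proof (rule C_k_on_SucI[OF assms(1), where D = "\<lambda>p h. cos (\<theta> p) * ?D p h"])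
    show "((\<lambda>p. sin (\<theta> p)) has_derivative (\<lambda>h. cos (\<theta> p) * ?D p h)) (at p)" if "p \<in> U" for p
      using has_derivative_sin[OF D[OF that]] by (simp add: mult.commute)
  qed (intro mult sc dk)
  moreover have "C_k_on (Suc k) U (\<lambda>p. cos (\<theta> p))"
  proof (rule C_k_on_SucI[OF assms(1), where D = "\<lambda>p h. (- 1) * (sin (\<theta> p) * ?D p h)"])
    show "((\<lambda>p. cos (\<theta> p)) has_derivative (\<lambda>h. (- 1) * (sin (\<theta> p) * ?D p h))) (at p)"
      if "p \<in> U" for p
      using has_derivative_cos[OF D[OF that]] by (simp add: mult.commute)
  qed (intro mult sc dk C_k_on_const assms(1))
  ultimately show ?case ..
qed

lemma smooth_on_cong:
  "open U \<Longrightarrow> (\<And>p. p \<in> U \<Longrightarrow> f p = g p) \<Longrightarrow> smooth_on U f \<Longrightarrow> smooth_on U g"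
  unfolding smooth_on_def by (intro allI, rule C_k_on_cong[of U f]) auto

lemma smooth_on_add:
  "open U \<Longrightarrow> smooth_on U f \<Longrightarrow> smooth_on U g \<Longrightarrow> smooth_on U (\<lambda>p. f p + g p)"
  by (simp add: smooth_on_def C_k_on_add)

lemma smooth_on_bilinear:
  "bounded_bilinear B \<Longrightarrow> open U \<Longrightarrow> smooth_on U f \<Longrightarrow> smooth_on U g \<Longrightarrow>
    smooth_on U (\<lambda>p. B (f p) (g p))"
  by (simp add: smooth_on_def C_k_on_bilinear)

lemma smooth_on_sin_cos:
  fixes \<theta> :: "'a::real_normed_vector \<Rightarrow> real"
  assumes "open U" "smooth_on U \<theta>"
  shows "smooth_on U (\<lambda>p. sin (\<theta> p))" "smooth_on U (\<lambda>p. cos (\<theta> p))"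
  using assms C_k_on_sin_cos by (auto simp: smooth_on_def)

lemma smooth_on_has_derivative:
  assumes "smooth_on U f" "p \<in> U"
  shows "(f has_derivative frechet_derivative f (at p)) (at p)"
  by (rule C_k_on_Suc_has_derivative[of 0 U f, OF _ assms(2)])
    (use assms(1) in \<open>simp only: smooth_on_def\<close>)

lemma smooth_on_continuous_on: "smooth_on U f \<Longrightarrow> continuous_on U f"
  by (simp add: smooth_on_def flip: C_k_on.simps(1))

section \<open>Smooth angle functions\<close>

text \<open>
  Near \<open>p\<close> one has \<open>\<theta> = \<theta>(p) + arcsin (sin (\<theta> - \<theta>(p)))\<close>, and the addition theorem turns the
  argument of the arcsine into a combination of \<open>sin \<theta>\<close> and \<open>cos \<theta>\<close> with constant coefficients.
  Continuity of \<open>\<theta>\<close> is what keeps \<open>\<theta> - \<theta>(p)\<close> in the range of the arcsine.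
\<close>

lemma continuous_angle_has_derivative:
  fixes \<theta> :: "'a::real_normed_vector \<Rightarrow> real"
  assumes U: "open U" "p \<in> U" and cont: "continuous_on U \<theta>"
    and S: "((\<lambda>q. sin (\<theta> q)) has_derivative S) (at p)"
    and C: "((\<lambda>q. cos (\<theta> q)) has_derivative C) (at p)"
  shows "(\<theta> has_derivative (\<lambda>h. cos (\<theta> p) * S h - sin (\<theta> p) * C h)) (at p)"
proof -
  define y where "y = (\<lambda>q. cos (\<theta> p) * sin (\<theta> q) - sin (\<theta> p) * cos (\<theta> q))"
  have y: "y q = sin (\<theta> q - \<theta> p)" for q
    by (simp add: y_def sin_diff mult.commute)
  have dy: "(y has_derivative (\<lambda>h. cos (\<theta> p) * S h - sin (\<theta> p) * C h)) (at p)"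
    unfolding y_def by (intro has_derivative_diff has_derivative_mult_right S C)
  (* y vanishes at p, and arcsin has slope 1 at 0. *)
  have "(arcsin has_derivative (*) 1) (at (y p))"
    using DERIV_arcsin[of 0] by (simp add: y has_field_derivative_def)
  from has_derivative_add[OF has_derivative_const has_derivative_compose[OF dy this]]
  have d: "((\<lambda>q. \<theta> p + arcsin (y q)) has_derivative
      (\<lambda>h. cos (\<theta> p) * S h - sin (\<theta> p) * C h)) (at p)"
    by simp
  let ?V = "U \<inter> \<theta> -` {\<theta> p - pi/2 <..< \<theta> p + pi/2}"
  have "open ?V" by (rule continuous_open_preimage[OF cont U(1)]) simp
  moreover have "p \<in> ?V" using U by simp
  moreover have "\<theta> p + arcsin (y q) = \<theta> q" if "q \<in> ?V" for q
    using that arcsin_sin[of "\<theta> q - \<theta> p"] by (auto simp: y)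
  ultimately show ?thesis
    by (rule has_derivative_transform_within_open[OF d])
qed

text \<open>
  The derivative formula \<open>D\<theta> = cos \<theta> D(sin \<theta>) - sin \<theta> D(cos \<theta>)\<close> only involves functions already
  known to be smooth, so all orders of smoothness follow at once.
\<close>

lemma smooth_on_continuous_angle:
  fixes \<theta> :: "'a::real_normed_vector \<Rightarrow> real"
  assumes U: "open U" and cont: "continuous_on U \<theta>"
    and S: "smooth_on U (\<lambda>p. sin (\<theta> p))" and C: "smooth_on U (\<lambda>p. cos (\<theta> p))"
  shows "smooth_on U \<theta>"
  unfolding smooth_on_def
proof
  fix k
  show "C_k_on k U \<theta>"
  proof (cases k)
    case 0
    with cont show ?thesis by simp
  next
    case (Suc j)
    let ?S = "\<lambda>p. frechet_derivative (\<lambda>q. sin (\<theta> q)) (at p)"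
    let ?C = "\<lambda>p. frechet_derivative (\<lambda>q. cos (\<theta> q)) (at p)"
    have k: "C_k_on j U (\<lambda>p. sin (\<theta> p))" "C_k_on j U (\<lambda>p. cos (\<theta> p))"
      "C_k_on (Suc j) U (\<lambda>p. sin (\<theta> p))" "C_k_on (Suc j) U (\<lambda>p. cos (\<theta> p))"
      using S C unfolding smooth_on_def by blast+
    have "C_k_on (Suc j) U \<theta>"
    proof (rule C_k_on_SucI[OF U])
      show "(\<theta> has_derivative (\<lambda>h. cos (\<theta> p) * ?S p h - sin (\<theta> p) * ?C p h)) (at p)"
        if "p \<in> U" for p
        using continuous_angle_has_derivative[OF U that cont]
          smooth_on_has_derivative[OF S that] smooth_on_has_derivative[OF C that] by blast
      show "C_k_on j U (\<lambda>p. cos (\<theta> p) * ?S p h - sin (\<theta> p) * ?C p h)" for h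
        using k by (intro C_k_on_diff U C_k_on_bilinear[OF bounded_bilinear_mult]) auto
    qed
    with Suc show ?thesis by simp
  qed
qed

text \<open>
  The circle-valued map \<open>c + \<i> d\<close> has a continuous logarithm on a simply connected open set; its
  real part vanishes since the map has modulus one, and its imaginary part is the angle.
\<close>

lemma smooth_angle_lift:
  fixes c d :: "'a::real_normed_vector \<Rightarrow> real"
  assumes U: "open U" "simply_connected U" and c: "smooth_on U c" and d: "smooth_on U d"
    and circle: "\<And>p. p \<in> U \<Longrightarrow> (c p)\<^sup>2 + (d p)\<^sup>2 = 1"
  obtains \<theta> where "smooth_on U \<theta>" "\<And>p. p \<in> U \<Longrightarrow> cos (\<theta> p) = c p" "\<And>p. p \<in> U \<Longrightarrow> sin (\<theta> p) = d p"
proof -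
  let ?z = "\<lambda>p. Complex (c p) (d p)"
  have cz: "continuous_on U ?z"
    unfolding Complex_eq
    by (intro continuous_intros smooth_on_continuous_on c d)
  have nz: "norm (?z p) = 1" if "p \<in> U" for p
    using circle[OF that] by (simp add: cmod_def)
  have "?z p \<noteq> 0" if "p \<in> U" for p
    using nz[OF that] by force
  then obtain g where g: "continuous_on U g" "\<And>p. p \<in> U \<Longrightarrow> ?z p = exp (g p)"
    using continuous_logarithm_on_simply_connected[OF cz U(2) open_imp_locally_path_connected[OF U(1)]]
    by blast
  define \<theta> where "\<theta> = (\<lambda>p. Im (g p))"
  have "exp (Re (g p)) = 1" if "p \<in> U" for p
    using nz[OF that] g(2)[OF that] by (metis norm_exp_eq_Re)
  then have cs: "cos (\<theta> p) = c p" "sin (\<theta> p) = d p" if "p \<in> U" for p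
    using that arg_cong[OF g(2)[OF that], of Re] arg_cong[OF g(2)[OF that], of Im]
    by (simp_all add: \<theta>_def Re_exp Im_exp)
  have "smooth_on U (\<lambda>p. cos (\<theta> p))" "smooth_on U (\<lambda>p. sin (\<theta> p))"
    using smooth_on_cong[OF U(1) _ c] smooth_on_cong[OF U(1) _ d] cs by simp_all
  moreover have "continuous_on U \<theta>"
    unfolding \<theta>_def by (intro continuous_intros g(1))
  ultimately have "smooth_on U \<theta>" using smooth_on_continuous_angle[OF U(1)] by blast
  then show ?thesis using that cs by blast
qed

section \<open>Orthonormal frames and offset surfaces\<close>

text \<open>
  Parseval's identity for the frame \<open>n, s, n \<times> s\<close>. In coordinates it is the expansion of the
  Gram determinant of \<open>m, n, s\<close>, which equals the square of \<open>m \<bullet> (n \<times> s)\<close>.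
\<close>

lemma frame_parseval:
  fixes m n s :: "real^3"
  assumes "n \<bullet> n = 1" "s \<bullet> s = 1" "n \<bullet> s = 0"
  shows "(m \<bullet> n)\<^sup>2 + (m \<bullet> s)\<^sup>2 + (m \<bullet> cross3 n s)\<^sup>2 = m \<bullet> m"
proof -
  have "(m \<bullet> cross3 n s)\<^sup>2 = (m \<bullet> m) * ((n \<bullet> n) * (s \<bullet> s) - (n \<bullet> s)\<^sup>2)
      - (m \<bullet> n) * ((m \<bullet> n) * (s \<bullet> s) - (n \<bullet> s) * (m \<bullet> s))
      + (m \<bullet> s) * ((m \<bullet> n) * (n \<bullet> s) - (n \<bullet> n) * (m \<bullet> s))"
    by (simp add: cross3_def inner_vec_def sum_3) algebra
  then show ?thesis using assms by (simp add: power2_eq_square)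
qed

lemma smooth_on_frame_t:
  "open U \<Longrightarrow> smooth_on U n \<Longrightarrow> smooth_on U s \<Longrightarrow> smooth_on U (frame_t n s)"
  unfolding frame_t_def
  by (rule smooth_on_bilinear[OF bilinear_conv_bounded_bilinear[THEN iffD1, OF bilinear_cross]])

text \<open>
  Differentiating the coefficient \<open>l\<close> only contributes along the direction of displacement \<open>t\<close>,
  which is invisible to a vector \<open>m\<close> orthogonal to \<open>t\<close>.
\<close>

lemma deriv_offset_inner:
  fixes x t :: "'a::real_normed_vector \<Rightarrow> 'b::real_inner" and l :: "'a \<Rightarrow> real"
  assumes "open U" "p \<in> U" "smooth_on U x" "smooth_on U t" "smooth_on U l"
    and x': "\<And>q. q \<in> U \<Longrightarrow> x' q = x q + l q *\<^sub>R t q" and m: "t p \<bullet> m = 0"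
  shows "frechet_derivative x' (at p) h \<bullet> m
    = (frechet_derivative x (at p) h + l p *\<^sub>R frechet_derivative t (at p) h) \<bullet> m"
proof -
  note D = smooth_on_has_derivative[OF _ assms(2)]
  have "((\<lambda>q. x q + l q *\<^sub>R t q) has_derivative
      (\<lambda>h. frechet_derivative x (at p) h +
        (l p *\<^sub>R frechet_derivative t (at p) h + frechet_derivative l (at p) h *\<^sub>R t p))) (at p)"
    by (intro has_derivative_add has_derivative_scaleR D assms)
  then have "(x' has_derivative
      (\<lambda>h. frechet_derivative x (at p) h +
        (l p *\<^sub>R frechet_derivative t (at p) h + frechet_derivative l (at p) h *\<^sub>R t p))) (at p)"
    by (rule has_derivative_transform_within_open[OF _ assms(1,2)]) (simp add: x')
  from frechet_derivative_at[OF this, symmetric] m show ?thesis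
    by (simp add: inner_add_left)
qed

theorem theorem3p23:
  fixes U :: "(real \<times> real) set"
    and x n s :: "real \<times> real \<Rightarrow> real^3"
    and a1 b1 e1 f1 g1 a2 b2 e2 f2 g2 :: "real \<times> real \<Rightarrow> real"
  assumes "simply_connected_domain U"
    and "framed_surface U x n s"
    and "basic_invariants U x n s a1 b1 e1 f1 g1 a2 b2 e2 f2 g2"
  shows "Bertrand_framed_surface U Dir_t Dir_s x n s \<longleftrightarrow>
    (\<exists>l \<theta> :: real \<times> real \<Rightarrow> real.
       smooth_on U l \<and> smooth_on U \<theta> \<and> densely_nonzero_on U l \<and>
       (\<forall>p\<in>U.
          (vector [vector [l p * f1 p, a1 p - l p * g1 p],
                   vector [l p * f2 p, a2 p - l p * g2 p]] :: real^2^2)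
            *v (vector [- sin (\<theta> p), cos (\<theta> p)] :: real^2) = 0))"
    (is "_ \<longleftrightarrow> (\<exists>l \<theta>. ?R l \<theta>)")
proof -
  define t where "t = frame_t n s"
  have U: "open U" "simply_connected U"
    using assms(1) by (auto simp: simply_connected_domain_def)
  have smooth: "smooth_on U x" "smooth_on U n" "smooth_on U s"
    using assms(2) by (auto simp: framed_surface_def)
  have smooth_t: "smooth_on U t" unfolding t_def using smooth_on_frame_t U smooth by blast
  have ons: "n p \<bullet> n p = 1" "s p \<bullet> s p = 1" "n p \<bullet> s p = 0" if "p \<in> U" for p
    using assms(2) that by (auto simp: framed_surface_def Delta_def norm_eq_1)
  have ont: "t p \<bullet> t p = 1" "t p \<bullet> n p = 0" "t p \<bullet> s p = 0" if "p \<in> U" for p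
    using ons[OF that]
    by (simp_all add: t_def frame_t_def dot_cross dot_cross_self inner_commute[of "s p" "n p"])
  have inv: "partial_u x p = a1 p *\<^sub>R s p + b1 p *\<^sub>R t p" "partial_u t p = - f1 p *\<^sub>R n p - g1 p *\<^sub>R s p"
    "partial_v x p = a2 p *\<^sub>R s p + b2 p *\<^sub>R t p" "partial_v t p = - f2 p *\<^sub>R n p - g2 p *\<^sub>R s p"
    if "p \<in> U" for p
    using assms(3) that unfolding basic_invariants_def Let_def t_def by blast+
  have matrix: "(vector [vector [l p * f1 p, a1 p - l p * g1 p],
                   vector [l p * f2 p, a2 p - l p * g2 p]] :: real^2^2)
            *v (vector [- sin (\<theta> p), cos (\<theta> p)] :: real^2) = 0
      \<longleftrightarrow> (a1 p - l p * g1 p) * cos (\<theta> p) - l p * f1 p * sin (\<theta> p) = 0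
        \<and> (a2 p - l p * g2 p) * cos (\<theta> p) - l p * f2 p * sin (\<theta> p) = 0" for l \<theta> p
    by (simp add: vec_eq_iff forall_2 matrix_vector_mult_def sum_2 algebra_simps)
  (* m has no t-component, so only the s- and n-components of x'_u and x'_v survive; the two
     right-hand sides turn into the rows of the system once m = sin \<theta> n + cos \<theta> s. *)
  have offset: "partial_u x' p \<bullet> m = (a1 p - l p * g1 p) * (m \<bullet> s p) - l p * f1 p * (m \<bullet> n p)"
    "partial_v x' p \<bullet> m = (a2 p - l p * g2 p) * (m \<bullet> s p) - l p * f2 p * (m \<bullet> n p)"
    if p: "p \<in> U" and l: "smooth_on U l" and x': "\<And>q. q \<in> U \<Longrightarrow> x' q = x q + l q *\<^sub>R t q"
      and m: "t p \<bullet> m = 0" for x' l p m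
    using deriv_offset_inner[OF U(1) p smooth(1) smooth_t l x' m, of "(1, 0)"]
      deriv_offset_inner[OF U(1) p smooth(1) smooth_t l x' m, of "(0, 1)"] m
    unfolding partial_u_def[symmetric] partial_v_def[symmetric] inv[OF p]
    by (simp_all add: inner_add_left inner_diff_left inner_commute algebra_simps)
  show ?thesis
  proof
    assume "Bertrand_framed_surface U Dir_t Dir_s x n s"
    then obtain x' n' s' l where f': "framed_surface U x' n' s'"
      and l: "smooth_on U l" "densely_nonzero_on U l"
      and x': "\<And>p. p \<in> U \<Longrightarrow> x' p = x p + l p *\<^sub>R t p" and s': "\<And>p. p \<in> U \<Longrightarrow> s' p = t p"
      by (auto simp: Bertrand_framed_surface_def mates_def t_def)
    have n': "smooth_on U n'" using f' by (simp add: framed_surface_def)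
    have f'': "n' p \<bullet> n' p = 1" "t p \<bullet> n' p = 0" "partial_u x' p \<bullet> n' p = 0" "partial_v x' p \<bullet> n' p = 0"
      if "p \<in> U" for p
      using f' that s'[OF that] by (auto simp: framed_surface_def Delta_def norm_eq_1 inner_commute)
    (* n' is a unit vector orthogonal to s' = t, hence lies on the unit circle of span {n, s}. *)
    have "(n' p \<bullet> s p)\<^sup>2 + (n' p \<bullet> n p)\<^sup>2 = 1" if "p \<in> U" for p
      using frame_parseval[OF ons[OF that], of "n' p"] f''[OF that]
      by (simp add: t_def frame_t_def inner_commute)
    then obtain \<theta> where \<theta>: "smooth_on U \<theta>" "\<And>p. p \<in> U \<Longrightarrow> cos (\<theta> p) = n' p \<bullet> s p"
        "\<And>p. p \<in> U \<Longrightarrow> sin (\<theta> p) = n' p \<bullet> n p"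
      using smooth_angle_lift[OF U smooth_on_bilinear[OF bounded_bilinear_inner U(1) n' smooth(3)]
        smooth_on_bilinear[OF bounded_bilinear_inner U(1) n' smooth(2)]] by blast
    have "?R l \<theta>"
      unfolding matrix using offset[OF _ l(1) x'] f'' l \<theta> by simp
    then show "\<exists>l \<theta>. ?R l \<theta>" by blast
  next
    assume "\<exists>l \<theta>. ?R l \<theta>"
    then obtain l \<theta> where l: "smooth_on U l" "densely_nonzero_on U l" and \<theta>: "smooth_on U \<theta>"
      and eq: "\<And>p. p \<in> U \<Longrightarrow> (a1 p - l p * g1 p) * cos (\<theta> p) - l p * f1 p * sin (\<theta> p) = 0"
        "\<And>p. p \<in> U \<Longrightarrow> (a2 p - l p * g2 p) * cos (\<theta> p) - l p * f2 p * sin (\<theta> p) = 0"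
      unfolding matrix by blast
    define x' where "x' = (\<lambda>p. x p + l p *\<^sub>R t p)"
    define n' where "n' = (\<lambda>p. sin (\<theta> p) *\<^sub>R n p + cos (\<theta> p) *\<^sub>R s p)"
    have "smooth_on U x'" "smooth_on U n'"
      unfolding x'_def n'_def
      by (intro smooth_on_add smooth_on_bilinear[OF bounded_bilinear_scaleR] smooth_on_sin_cos
          U smooth smooth_t l \<theta>)+
    moreover have inn: "n' p \<bullet> n p = sin (\<theta> p)" "n' p \<bullet> s p = cos (\<theta> p)" "t p \<bullet> n' p = 0"
        if "p \<in> U" for p
      using ons[OF that] ont[OF that] by (simp_all add: n'_def inner_add_left inner_add_right inner_commute)
    moreover have "n' p \<bullet> n' p = 1" if "p \<in> U" for p
      using frame_parseval[OF ons[OF that], of "n' p"] inn[OF that]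
      by (simp add: t_def frame_t_def inner_commute)
    moreover have "partial_u x' p \<bullet> n' p = 0" "partial_v x' p \<bullet> n' p = 0" if "p \<in> U" for p
      using offset[OF that l(1), of x' "n' p"] inn[OF that] eq[OF that] by (simp_all add: x'_def)
    ultimately have "framed_surface U x' n' t"
      using smooth_t ont by (simp add: framed_surface_def Delta_def norm_eq_1 inner_commute)
    then have "mates U Dir_t Dir_s x n s x' n' t"
      using assms(2) l by (auto simp: mates_def x'_def t_def)
    then show "Bertrand_framed_surface U Dir_t Dir_s x n s"
      unfolding Bertrand_framed_surface_def by blast
  qed
qed

end
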